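(* Let $p,r\ge 1$ and $q\ge 2$ be integers, and let $\Gamma=\mathcal{C}_{p,q,r}$ where $q>p>r$ (equivalently, $q>r>p$). Then $\beta(\mathcal{C}_{p,q,r})=2$.
   Context: For a connected graph $\Gamma$ with vertex set $V(\Gamma)$, $d(u,v)$ is the length (number of edges) of a shortest path between $u$ and $v$. For an ordered set $R=\{w_1,\dots,w_t\}\subseteq V(\Gamma)$, the representation of a vertex $v$ with respect to $R$ is $(d(v,w_1),\dots,d(v,w_t))$. $R$ is a resolving set if distinct vertices have distinct representations with respect to $R$. The metric dimension $\beta(\Gamma)$ is the minimum cardinality of a resolving set of $\Gamma$. The graph $\mathcal{C}_{p,q,r}$ (base bicyclic graph of type III), for integers $p,r\ge 1$ and $q\ge 2$, is defined as follows. Take three disjoint paths $\mathcal{P}_1=v_1\cdots v_p$, $\mathcal{P}_2=v_{p+1}\cdots v_{p+q}$ and $\mathcal{P}_3=v_{p+q+1}\cdots v_{p+q+r}$ having $p$, $q$ and $r$ vertices respectively; join the starting vertices $v_1$ and $v_{p+q+1}$ of $\mathcal{P}_1$ and $\mathcal{P}_3$ to the starting vertex $v_{p+1}$ of $\mathcal{P}_2$, and join the ending vertices $v_p$ and $v_{p+q+r}$ of $\mathcal{P}_1$ and $\mathcal{P}_3$ to the ending vertex $v_{p+q}$ of $\mathcal{P}_2$ (a one-vertex path has its starting vertex equal to its ending vertex). Thus $v_{p+1}$ and $v_{p+q}$ are joined by three internally disjoint paths of lengths $p+1$, $q-1$, $r+1$. Interchanging $p$ and $r$ gives an isomorphic graph: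 $\mathcal{C}_{p,q,r}\simeq\mathcal{C}_{r,q,p}$. *)

theory Defs
  imports "Graph_Theory.Graph_Theory"
begin

text \<open>
  A simple undirected graph is a \<^locale>\<open>pair_graph\<close>: an edge \<open>{u, v}\<close> is represented by the two
  opposite arcs \<open>(u, v)\<close> and \<open>(v, u)\<close>. An \<open>apath\<close> carries the list of its arcs, so its length is
  the number of edges of the path.
\<close>

definition graph_dist :: "'a pair_pre_digraph \<Rightarrow> 'a \<Rightarrow> 'a \<Rightarrow> nat" where
  \<comment> \<open>unspecified if \<open>u\<close> and \<open>v\<close> are not joined by a path; only meant for connected graphs\<close>
  "graph_dist G u v = (LEAST n. \<exists>xs. pre_digraph.apath (with_proj G) u xs v \<and> length xs = n)"

definition representation :: "'a pair_pre_digraph \<Rightarrow> 'a list \<Rightarrow> 'a \<Rightarrow> nat list" where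
  "representation G R v = map (graph_dist G v) R"

text \<open>Ordered sets of vertices are duplicate-free lists.\<close>

definition resolving_set :: "'a pair_pre_digraph \<Rightarrow> 'a list \<Rightarrow> bool" where
  "resolving_set G R \<longleftrightarrow>
     distinct R \<and> set R \<subseteq> pverts G \<and> inj_on (representation G R) (pverts G)"

definition metric_dimension :: "'a pair_pre_digraph \<Rightarrow> nat" where
  "metric_dimension G = (LEAST k. \<exists>R. resolving_set G R \<and> card (set R) = k)"

text \<open>
  The base bicyclic graph of type III, meant for \<open>p, r \<ge> 1\<close> and \<open>q \<ge> 2\<close>; the vertex \<open>v\<^sub>i\<close> is the
  number \<open>i\<close>. The first three sets are the paths \<open>P\<^sub>1\<close>, \<open>P\<^sub>2\<close>, \<open>P\<^sub>3\<close>, the last one joins the starting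
  vertices and the ending vertices of \<open>P\<^sub>1\<close> and \<open>P\<^sub>3\<close> to those of \<open>P\<^sub>2\<close>.
\<close>

definition bicyclic_edges :: "nat \<Rightarrow> nat \<Rightarrow> nat \<Rightarrow> (nat \<times> nat) set" where
  "bicyclic_edges p q r =
     {(i, i + 1) | i. 1 \<le> i \<and> i < p} \<union>
     {(i, i + 1) | i. p + 1 \<le> i \<and> i < p + q} \<union>
     {(i, i + 1) | i. p + q + 1 \<le> i \<and> i < p + q + r} \<union>
     {(1, p + 1), (p + q + 1, p + 1), (p, p + q), (p + q + r, p + q)}"

definition bicyclic :: "nat \<Rightarrow> nat \<Rightarrow> nat \<Rightarrow> nat pair_pre_digraph" where
  "bicyclic p q r =
     \<lparr> pverts = {1..p + q + r},
       parcs = bicyclic_edges p q r \<union> (bicyclic_edges p q r)\<inverse> \<rparr>"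

lemma pair_graph_bicyclic:
  assumes "p \<ge> 1" "q \<ge> 2" "r \<ge> 1"
  shows "pair_graph (bicyclic p q r)"
proof
  let ?G = "bicyclic p q r"
  show wf1: "fst e \<in> pverts ?G" if "e \<in> parcs ?G" for e
    using that assms by (auto simp: bicyclic_def bicyclic_edges_def)
  show wf2: "snd e \<in> pverts ?G" if "e \<in> parcs ?G" for e
    using that assms by (auto simp: bicyclic_def bicyclic_edges_def)
  show fin: "finite (pverts ?G)"
    by (simp add: bicyclic_def)
  have "parcs ?G \<subseteq> pverts ?G \<times> pverts ?G"
    using wf1 wf2 by (auto simp: mem_Times_iff)
  then show "finite (parcs ?G)"
    using fin finite_subset by blast
  show "fst e \<noteq> snd e" if "e \<in> parcs ?G" for e
    using that assms by (auto simp: bicyclic_def bicyclic_edges_def)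
  show "symmetric (with_proj ?G)"
    by (auto simp: symmetric_def sym_def bicyclic_def)
qed

lemma connected_bicyclic:
  assumes "p \<ge> 1" "q \<ge> 2" "r \<ge> 1"
  shows "connected (with_proj (bicyclic p q r))"
proof -
  let ?G = "bicyclic p q r"
  interpret pair_graph ?G
    using assms by (rule pair_graph_bicyclic)
  have adj: "(i + 1) \<rightarrow>\<^sup>*\<^bsub>with_proj ?G\<^esub> i"
    if "1 \<le> i" "i < p + q + r" "i \<noteq> p" "i \<noteq> p + q" for i
    using that by (intro reachable_adjI) (auto simp: bicyclic_def bicyclic_edges_def)
  have join: "1 \<rightarrow>\<^sup>*\<^bsub>with_proj ?G\<^esub> (p + 1)" "(p + q + 1) \<rightarrow>\<^sup>*\<^bsub>with_proj ?G\<^esub> (p + 1)"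
    by (intro reachable_adjI; auto simp: bicyclic_def bicyclic_edges_def)+
  have centre: "(p + 1) \<rightarrow>\<^sup>*\<^bsub>with_proj ?G\<^esub> (p + 1)"
    using assms by (intro reachable_refl) (auto simp: bicyclic_def)
  have to_centre: "v \<rightarrow>\<^sup>*\<^bsub>with_proj ?G\<^esub> (p + 1)" if "1 \<le> v" "v \<le> p + q + r" for v
    using that
  proof (induction v rule: nat_induct_at_least)
    case base
    then show ?case using join by simp
  next
    case (Suc n)
    show ?case
    proof (cases "n = p \<or> n = p + q")
      case True
      then show ?thesis using centre join by auto
    next
      case False
      then have "Suc n \<rightarrow>\<^sup>*\<^bsub>with_proj ?G\<^esub> n"
        using adj[of n] Suc by auto
      moreover have "n \<rightarrow>\<^sup>*\<^bsub>with_proj ?G\<^esub> (p + 1)"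
        using Suc by simp
      ultimately show ?thesis by (rule reachable_trans)
    qed
  qed
  have "strongly_connected (with_proj ?G)"
  proof (rule strongly_connectedI)
    fix u v assume "u \<in> verts (with_proj ?G)" "v \<in> verts (with_proj ?G)"
    then have "1 \<le> u \<and> u \<le> p + q + r" "1 \<le> v \<and> v \<le> p + q + r"
      by (auto simp: bicyclic_def)
    then have "u \<rightarrow>\<^sup>*\<^bsub>with_proj ?G\<^esub> (p + 1)" "v \<rightarrow>\<^sup>*\<^bsub>with_proj ?G\<^esub> (p + 1)"
      by (blast intro: to_centre)+
    then show "u \<rightarrow>\<^sup>*\<^bsub>with_proj ?G\<^esub> v"
      by (blast intro: reachable_trans symmetric_reachable')
  qed (use assms in \<open>auto simp: bicyclic_def\<close>)
  then show ?thesis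
    unfolding connected_def strongly_connected_def by (auto intro: reachable_mk_symmetricI)
qed

end

theory Submission
  imports Defs
begin

text \<open>
  One vertex never resolves the graph, because it has two neighbours. For two landmarks let
  \<open>q > p > r\<close>, so that \<open>P\<^sub>3\<close> gives the shortest of the three paths between the branch vertices
  \<open>v\<^bsub>p+1\<^esub>\<close> and \<open>v\<^bsub>p+q\<^esub>\<close>. Take \<open>v\<^sub>s\<close> with \<open>s = \<lceil>(p - r) / 2\<rceil>\<close>: up to parity it is antipodal to
  \<open>v\<^bsub>p+q\<^esub>\<close> on the cycle through \<open>P\<^sub>1\<close> and \<open>P\<^sub>3\<close>, so its distance grows along all of \<open>P\<^sub>3\<close>. Together
  with \<open>v\<^bsub>p+2\<^esub>\<close>, the second vertex of \<open>P\<^sub>2\<close>, it resolves the graph, except for \<open>p = r + 1\<close>,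
  \<open>q = r + 3\<close>, where \<open>v\<^sub>1\<close> and \<open>v\<^bsub>p+q\<^esub>\<close> do. All distances are certified by explicit formulas: a
  nonnegative function is the distance to \<open>x\<close> if it vanishes at \<open>x\<close>, changes by at most one along
  edges, and drops by one along some edge at every other vertex.
\<close>

section \<open>Certificates for distances\<close>

definition distance_to :: "'a pair_pre_digraph \<Rightarrow> 'a \<Rightarrow> ('a \<Rightarrow> int) \<Rightarrow> bool" where
  "distance_to G x f \<longleftrightarrow>
     x \<in> pverts G \<and> f x = 0 \<and> (\<forall>v \<in> pverts G. 0 \<le> f v) \<and>
     (\<forall>u v. (u, v) \<in> parcs G \<longrightarrow> f u \<le> f v + 1) \<and>
     (\<forall>v \<in> pverts G. v \<noteq> x \<longrightarrow> (\<exists>w. (v, w) \<in> parcs G \<and> f v = f w + 1))"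

context pair_wf_digraph
begin

text \<open>Each arc of a walk lowers \<open>f\<close> by at most one, and \<open>f\<close> has to
  come down to 0 at \<open>x\<close>.\<close>

lemma distance_to_le_length:
  assumes f: "distance_to G x f" and w: "awalk v xs x"
  shows "f v \<le> int (length xs)"
  using w
proof (induction xs arbitrary: v)
  case Nil
  then show ?case using f by (simp add: awalk_Nil_iff distance_to_def)
next
  case (Cons e es)
  then have "e \<in> parcs G" "fst e = v" "f (snd e) \<le> int (length es)"
    by (auto simp: awalk_Cons_iff)
  moreover from this have "f v \<le> f (snd e) + 1"
    using f by (cases e) (auto simp: distance_to_def)
  ultimately show ?case by simp
qed

text \<open>Descending arcs are followed until \<open>x\<close> is reached. The bound on the values
  along the path serves the induction: the vertex put in front has a larger value than all later
  ones, so no vertex repeats.\<close>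

lemma distance_to_apath:
  assumes f: "distance_to G x f" and v: "v \<in> pverts G"
  shows "\<exists>xs. apath v xs x \<and> int (length xs) = f v \<and> (\<forall>y \<in> set (awalk_verts v xs). f y \<le> f v)"
  using v
proof (induction "nat (f v)" arbitrary: v rule: less_induct)
  case less
  show ?case
  proof (cases "v = x")
    case True
    then show ?thesis using f less.prems
      by (intro exI[of _ "[]"]) (auto simp: apath_Nil_iff distance_to_def)
  next
    case False
    then obtain w where w: "(v, w) \<in> parcs G" "f v = f w + 1"
      using f less.prems unfolding distance_to_def by blast
    then have "w \<in> pverts G" using in_arcsD2 by auto
    moreover from this have "0 \<le> f w"
      using f by (simp add: distance_to_def)
    ultimately obtain xs
      where xs: "apath w xs x" "int (length xs) = f w" "\<forall>y \<in> set (awalk_verts w xs). f y \<le> f w"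
      using w less.hyps[of w] by auto
    then show ?thesis using w
      by (intro exI[of _ "(v, w) # xs"]) (fastforce simp: apath_Cons_iff)
  qed
qed

lemma graph_dist_eqI:
  assumes f: "distance_to G x f" and v: "v \<in> pverts G"
  shows "int (graph_dist G v x) = f v"
proof -
  have "graph_dist G v x = nat (f v)"
    unfolding graph_dist_def
  proof (rule Least_equality)
    show "\<exists>xs. apath v xs x \<and> length xs = nat (f v)"
      using distance_to_apath[OF assms] by force
    show "nat (f v) \<le> n" if "\<exists>xs. apath v xs x \<and> length xs = n" for n
      using that distance_to_le_length[OF f] awalkI_apath by fastforce
  qed
  then show ?thesis
    using f v by (simp add: distance_to_def)
qed

lemma graph_dist_arc:
  assumes "(v, w) \<in> parcs G" "v \<noteq> w"
  shows "graph_dist G v w = 1"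
  unfolding graph_dist_def
proof (rule Least_equality)
  have "w \<in> pverts G" "v \<in> pverts G" using assms in_arcsD1 in_arcsD2 by auto
  then show "\<exists>xs. apath v xs w \<and> length xs = 1"
    using assms by (intro exI[of _ "[(v, w)]"]) (auto simp: apath_Cons_iff apath_Nil_iff)
  show "1 \<le> n" if "\<exists>xs. apath v xs w \<and> length xs = n" for n
    using that assms by (cases n) (auto simp: apath_Nil_iff)
qed

lemma resolving_set_two:
  assumes f: "distance_to G x f" and g: "distance_to G y g" and "x \<noteq> y"
    and inj: "inj_on (\<lambda>v. (f v, g v)) (pverts G)"
  shows "resolving_set G [x, y]"
proof -
  have "map int (representation G [x, y] v) = [f v, g v]" if "v \<in> pverts G" for v
    using that f g by (simp add: representation_def graph_dist_eqI)
  then have "inj_on (representation G [x, y]) (pverts G)"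
    using inj unfolding inj_on_def by (metis list.inject prod.inject)
  then show ?thesis
    using assms by (auto simp: resolving_set_def distance_to_def)
qed

end

section \<open>Metric dimension two from a resolving pair\<close>

context pair_graph
begin

lemma metric_dimension_eq_two:
  assumes nbrs: "\<And>w. w \<in> pverts G \<Longrightarrow> \<exists>u v. u \<noteq> v \<and> (u, w) \<in> parcs G \<and> (v, w) \<in> parcs G"
    and ne: "pverts G \<noteq> {}" and xy: "resolving_set G [x, y]"
  shows "metric_dimension G = 2"
  unfolding metric_dimension_def
proof (rule Least_equality)
  show "\<exists>R. resolving_set G R \<and> card (set R) = 2"
    using xy by (intro exI[of _ "[x, y]"]) (auto simp: resolving_set_def)
next
  fix k assume "\<exists>R. resolving_set G R \<and> card (set R) = k"
  then obtain R where R: "distinct R" "set R \<subseteq> pverts G"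
      "inj_on (representation G R) (pverts G)" "length R = k"
    by (auto simp: resolving_set_def distinct_card)
  show "2 \<le> k"
  proof (rule ccontr)
    assume "\<not> 2 \<le> k"
    with R consider "R = []" | w where "R = [w]"
      by (cases R; cases "tl R") auto
    \<comment> \<open>The inclusion treats both cases at once: without landmarks all representations
      are empty, so any vertex can serve as \<open>w\<close>.\<close>
    then obtain w where w: "w \<in> pverts G" "set R \<subseteq> {w}"
      using ne R by cases auto
    obtain u v where uv: "u \<noteq> v" "(u, w) \<in> parcs G" "(v, w) \<in> parcs G"
      using nbrs[OF w(1)] by blast
    then have "u \<noteq> w" "v \<noteq> w" using no_loops by fastforce+
    with uv w have "representation G R u = representation G R v"
      by (auto simp: representation_def graph_dist_arc)
    moreover have "u \<in> pverts G" "v \<in> pverts G" using uv in_arcsD1 by auto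
    ultimately show False using R uv by (auto dest: inj_onD)
  qed
qed

end

section \<open>Transport of certificates along isomorphisms\<close>

lemma distance_to_vimage:
  assumes f: "distance_to G (\<phi> x) f" and x: "x \<in> pverts H"
    and bij: "bij_betw \<phi> (pverts H) (pverts G)"
    and arcs: "\<And>u v. u \<in> pverts H \<Longrightarrow> v \<in> pverts H \<Longrightarrow>
      (u, v) \<in> parcs H \<longleftrightarrow> (\<phi> u, \<phi> v) \<in> parcs G"
    and H: "pair_wf_digraph H" and G: "pair_wf_digraph G"
  shows "distance_to H x (f \<circ> \<phi>)"
proof -
  have wfH: "u \<in> pverts H" "v \<in> pverts H" if "(u, v) \<in> parcs H" for u v
    using pair_wf_digraph.in_arcsD1[OF H that] pair_wf_digraph.in_arcsD2[OF H that] by auto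
  have "\<exists>w. (v, w) \<in> parcs H \<and> f (\<phi> v) = f (\<phi> w) + 1" if v: "v \<in> pverts H" "v \<noteq> x" for v
  proof -
    have "\<phi> v \<in> pverts G" "\<phi> v \<noteq> \<phi> x"
      using v x bij by (auto simp: bij_betw_def inj_on_def)
    then obtain w where w: "(\<phi> v, w) \<in> parcs G" "f (\<phi> v) = f w + 1"
      using f unfolding distance_to_def by blast
    then have "w \<in> \<phi> ` pverts H"
      using bij pair_wf_digraph.in_arcsD2[OF G w(1)] by (auto simp: bij_betw_def)
    then show ?thesis using w arcs v by blast
  qed
  moreover have "f (\<phi> u) \<le> f (\<phi> v) + 1" if "(u, v) \<in> parcs H" for u v
    using f arcs[OF wfH[OF that]] that unfolding distance_to_def by blast
  moreover have "0 \<le> f (\<phi> v)" if "v \<in> pverts H" for v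
    using f bij_betwE[OF bij] that unfolding distance_to_def by blast
  ultimately show ?thesis
    using f x by (simp add: distance_to_def)
qed

section \<open>Adjacency in the bicyclic graph\<close>

lemma bicyclic_edges_iff:
  "(u, v) \<in> bicyclic_edges p q r \<longleftrightarrow>
     v = u + 1 \<and> (1 \<le> u \<and> u < p \<or> p + 1 \<le> u \<and> u < p + q \<or> p + q + 1 \<le> u \<and> u < p + q + r) \<or>
     u = 1 \<and> v = p + 1 \<or> u = p + q + 1 \<and> v = p + 1 \<or>
     u = p \<and> v = p + q \<or> u = p + q + r \<and> v = p + q"
  by (auto simp: bicyclic_edges_def)

lemma bicyclic_edgesE [consumes 1, case_names path1 path2 path3 start1 start3 end1 end3]:
  assumes "(u, v) \<in> bicyclic_edges p q r"
  obtains "v = u + 1" "1 \<le> u" "u < p" | "v = u + 1" "p + 1 \<le> u" "u < p + q"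
    | "v = u + 1" "p + q + 1 \<le> u" "u < p + q + r" | "u = 1" "v = p + 1"
    | "u = p + q + 1" "v = p + 1" | "u = p" "v = p + q" | "u = p + q + r" "v = p + q"
  using assms unfolding bicyclic_edges_iff by blast

lemma verts_bicyclic: "pverts (bicyclic p q r) = {1..p + q + r}"
  by (simp add: bicyclic_def)

lemma arcs_bicyclic_iff:
  "(u, v) \<in> parcs (bicyclic p q r) \<longleftrightarrow>
     (u, v) \<in> bicyclic_edges p q r \<or> (v, u) \<in> bicyclic_edges p q r"
  by (simp add: bicyclic_def)

lemma bicyclic_two_neighbours:
  assumes "p \<ge> 1" "q \<ge> 2" "r \<ge> 1" "w \<in> pverts (bicyclic p q r)"
  shows "\<exists>u v. u \<noteq> v \<and> (u, w) \<in> parcs (bicyclic p q r) \<and> (v, w) \<in> parcs (bicyclic p q r)"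
proof -
  note arc = verts_bicyclic arcs_bicyclic_iff bicyclic_edges_iff
  \<comment> \<open>Both neighbours follow the numbering and leave P1 and P3 for the branch
    vertices. At \<open>p + 1\<close> the predecessor is the start of P3, at \<open>p + q\<close>
    the successor is the end of P1. If P1 or P3 is a single vertex, its two neighbours
    \<open>p + 1\<close> and \<open>p + q\<close> differ because \<open>q \<ge> 2\<close>.\<close>
  define prev where
    "prev = (if w = 1 \<or> w = p + q + 1 then p + 1 else if w = p + 1 then p + q + 1 else w - 1)"
  define succ where
    "succ = (if w = p + q + r \<or> w = p then p + q else if w = p + q then p else w + 1)"
  have "prev \<noteq> succ"
    using assms unfolding prev_def succ_def verts_bicyclic by auto
  moreover have "(prev, w) \<in> parcs (bicyclic p q r)"
  proof -
    consider "w = 1" | "w = p + q + 1" | "w = p + 1" | "w \<noteq> 1" "w \<noteq> p + q + 1" "w \<noteq> p + 1"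
      by blast
    then show ?thesis
    proof cases
      case 4
      moreover obtain x where "w = x + 1"
        using assms(4) by (cases w) (auto simp: verts_bicyclic)
      ultimately show ?thesis
        using assms by (simp add: prev_def arc) linarith
    qed (use assms in \<open>simp_all add: prev_def arc\<close>)
  qed
  moreover have "(succ, w) \<in> parcs (bicyclic p q r)"
  proof -
    consider "w = p" | "w = p + q" | "w = p + q + r" | "w \<noteq> p" "w \<noteq> p + q" "w \<noteq> p + q + r"
      by blast
    then show ?thesis
    proof cases
      case 4
      then show ?thesis
        using assms by (simp add: succ_def arc) linarith
    qed (use assms in \<open>simp_all add: succ_def arc\<close>)
  qed
  ultimately show ?thesis by blast
qed

section \<open>Exchanging P1 and P3\<close>

text \<open>The isomorphism onto \<open>bicyclic r q p\<close>: the three blocks of numbers are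
  permuted and each keeps its order, so starts go to starts and ends to ends. In the middle block
  \<open>r\<close> is added before \<open>p\<close> is subtracted, so nothing is truncated.\<close>

definition swap_vertex :: "nat \<Rightarrow> nat \<Rightarrow> nat \<Rightarrow> nat \<Rightarrow> nat" where
  "swap_vertex p q r v =
     (if v \<le> p then v + q + r else if v \<le> p + q then v + r - p else v - (p + q))"

lemma swap_vertex_swap_vertex:
  assumes "v \<in> {1..p + q + r}"
  shows "swap_vertex p q r v \<in> {1..r + q + p}" "swap_vertex r q p (swap_vertex p q r v) = v"
  using assms by (auto simp: swap_vertex_def)

lemma bij_betw_swap_vertex:
  "bij_betw (swap_vertex p q r) (pverts (bicyclic p q r)) (pverts (bicyclic r q p))"
  unfolding verts_bicyclic
  by (rule bij_betw_byWitness[where f' = "swap_vertex r q p"])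
     (use swap_vertex_swap_vertex[of _ p q r] swap_vertex_swap_vertex[of _ r q p] in auto)

lemma edges_swap_vertex:
  assumes "p \<ge> 1" "q \<ge> 2" "r \<ge> 1" "(u, v) \<in> bicyclic_edges p q r"
  shows "(swap_vertex p q r u, swap_vertex p q r v) \<in> bicyclic_edges r q p"
  using assms(4)
proof (cases rule: bicyclic_edgesE)
  case path2
  moreover from this obtain i where "u = p + i"
    using le_Suc_ex[of p u] by auto
  ultimately show ?thesis
    using assms by (simp add: bicyclic_edges_iff swap_vertex_def)
next
  case path3
  moreover from this obtain i where "u = p + q + i"
    using le_Suc_ex[of "p + q" u] by auto
  ultimately show ?thesis
    using assms by (simp add: bicyclic_edges_iff swap_vertex_def)
qed (use assms in \<open>simp_all add: bicyclic_edges_iff swap_vertex_def\<close>)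

text \<open>The converse direction applies \<open>edges_swap_vertex\<close> to the exchanged graph,
  whose swap undoes this one.\<close>

lemma arcs_swap_vertex:
  assumes "p \<ge> 1" "q \<ge> 2" "r \<ge> 1" "u \<in> pverts (bicyclic p q r)" "v \<in> pverts (bicyclic p q r)"
  shows "(u, v) \<in> parcs (bicyclic p q r) \<longleftrightarrow>
    (swap_vertex p q r u, swap_vertex p q r v) \<in> parcs (bicyclic r q p)"
  using assms edges_swap_vertex[of p q r] edges_swap_vertex[of r q p]
    swap_vertex_swap_vertex[of _ p q r]
  unfolding arcs_bicyclic_iff verts_bicyclic by metis

section \<open>Explicit distance formulas\<close>

text \<open>
  The distances to \<open>v\<^sub>s\<close>, to \<open>v\<^bsub>p+2\<^esub>\<close> and to \<open>v\<^bsub>p+q\<^esub>\<close>, correct only in the ranges of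
  \<open>p\<close>, \<open>q\<close>, \<open>r\<close>, \<open>s\<close> in which they are used; the vertices are integers so that subtraction is
  not truncated.
\<close>

definition dist_P1 :: "int \<Rightarrow> int \<Rightarrow> int \<Rightarrow> int \<Rightarrow> int \<Rightarrow> int" where
  "dist_P1 s p q r v =
     (if v \<le> p then min \<bar>v - s\<bar> (p + r + 2 - \<bar>v - s\<bar>)
      else if v \<le> p + q then min (s + v - p - 1) (2 * p + q + 1 - s - v)
      else s + v - p - q)"

definition dist_P2_second :: "int \<Rightarrow> int \<Rightarrow> int \<Rightarrow> int \<Rightarrow> int" where
  "dist_P2_second p q r v =
     (if v \<le> p then min (v + 1) (min (q - 2) (r + 2) + p + 1 - v)
      else if v \<le> p + q then min \<bar>v - p - 2\<bar> (q + r - \<bar>v - p - 2\<bar>)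
      else min (v + 1 - p - q) (p + 2 * q + r - 1 - v))"

definition dist_P2_last :: "int \<Rightarrow> int \<Rightarrow> int \<Rightarrow> int \<Rightarrow> int" where
  "dist_P2_last p q r v =
     (if v \<le> p then p + 1 - v
      else if v = p + 1 then r + 1
      else if v \<le> p + q then p + q - v
      else p + q + r + 1 - v)"

text \<open>The part of a certificate that is pure integer arithmetic, one bound per edge and free
  of graph terms, so that it can be left to an SMT solver. The absolute values cover both
  orientations of an edge.\<close>

definition unit_steps :: "int \<Rightarrow> int \<Rightarrow> int \<Rightarrow> (int \<Rightarrow> int) \<Rightarrow> bool" where
  "unit_steps p q r f \<longleftrightarrow>
     (\<forall>v. 1 \<le> v \<and> v \<le> p + q + r \<longrightarrow> 0 \<le> f v) \<and>
     (\<forall>v. 1 \<le> v \<and> v < p + q + r \<and> v \<noteq> p \<and> v \<noteq> p + q \<longrightarrow> \<bar>f v - f (v + 1)\<bar> \<le> 1) \<and>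
     \<bar>f 1 - f (p + 1)\<bar> \<le> 1 \<and> \<bar>f (p + q + 1) - f (p + 1)\<bar> \<le> 1 \<and>
     \<bar>f p - f (p + q)\<bar> \<le> 1 \<and> \<bar>f (p + q + r) - f (p + q)\<bar> \<le> 1"

lemma distance_to_bicyclicI:
  fixes f :: "int \<Rightarrow> int" and p q r x :: nat
  assumes x: "x \<in> {1..p + q + r}" "f x = 0"
    and steps: "unit_steps p q r f"
    and descent: "\<And>v. 1 \<le> v \<Longrightarrow> v \<le> p + q + r \<Longrightarrow> v \<noteq> x \<Longrightarrow>
      \<exists>w. (v, w) \<in> parcs (bicyclic p q r) \<and> f v = f w + 1"
  shows "distance_to (bicyclic p q r) x (f \<circ> int)"
proof -
  have nonneg: "0 \<le> f (int v)" if "v \<in> {1..p + q + r}" for v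
    using steps that by (simp add: unit_steps_def)
  have path: "\<bar>f (int v) - f (int v + 1)\<bar> \<le> 1"
    if "1 \<le> v" "v < p + q + r" "v \<noteq> p" "v \<noteq> p + q" for v
    using steps that by (simp add: unit_steps_def)
  have "\<bar>f (int u) - f (int v)\<bar> \<le> 1" if "(u, v) \<in> bicyclic_edges p q r" for u v
    using that steps path[of u] unfolding unit_steps_def
    by (cases rule: bicyclic_edgesE) (auto simp: add.commute)
  then have "f (int u) \<le> f (int v) + 1" if "(u, v) \<in> parcs (bicyclic p q r)" for u v
    using that unfolding arcs_bicyclic_iff by force
  then show ?thesis
    using x nonneg descent unfolding distance_to_def verts_bicyclic by auto
qed

section \<open>The two distances determine the vertex\<close>

lemma inj_P1_P2_second:
  fixes p q r s u v :: int
  assumes "r \<ge> 1" "q > p" "p > r" "p = r + 2 * s \<or> p + 1 = r + 2 * s"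
    and "\<not> (p = r + 1 \<and> q = r + 3)"
    and "1 \<le> u" "u \<le> v" "v \<le> p + q + r"
    and "dist_P1 s p q r u = dist_P1 s p q r v"
    and "dist_P2_second p q r u = dist_P2_second p q r v"
  shows "u = v"
proof -
  consider "v \<le> p" | "u \<le> p" "p < v" "v \<le> p + q" | "u \<le> p" "p + q < v"
    | "p < u" "v \<le> p + q" | "p < u" "u \<le> p + q" "p + q < v" | "p + q < u"
    using assms by linarith
  then show ?thesis
  proof cases
    case 1
    with assms show ?thesis
      unfolding dist_P1_def dist_P2_second_def by (smt (verit))
  next
    case 2
    with assms show ?thesis
      unfolding dist_P1_def dist_P2_second_def by (smt (verit))
  next
    case 3
    with assms show ?thesis
      unfolding dist_P1_def dist_P2_second_def by (smt (verit))
  next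
    case 4
    then have first: "min (s + u - p - 1) (2 * p + q + 1 - s - u) =
        min (s + v - p - 1) (2 * p + q + 1 - s - v)"
      and second: "min \<bar>u - p - 2\<bar> (q + r - \<bar>u - p - 2\<bar>) =
        min \<bar>v - p - 2\<bar> (q + r - \<bar>v - p - 2\<bar>)"
      using assms(7,9,10) by (simp_all add: dist_P1_def dist_P2_second_def)
    \<comment> \<open>Two arguments at which \<open>min a b\<close> agrees, \<open>a + b\<close> being constant, are equal or mirror images.\<close>
    have sum: "u = v \<or> u + v = 3 * p + q + 2 - 2 * s"
      using first by (smt (verit))
    \<comment> \<open>Vertex \<open>p + 1\<close> is the only one of P2 before the landmark
      \<open>p + 2\<close>, so its ties are not of the mirror form used for the rest; it could tie
      only with \<open>p + 3\<close>.\<close>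
    show ?thesis
    proof (cases "u = p + 1")
      case True
      then show ?thesis
        using assms(1-4,7) 4 sum second by (smt (verit))
    next
      case False
      then have "u = v \<or> u + v = 2 * p + q + r + 4"
        using assms(7) 4 second by (smt (verit))
      \<comment> \<open>By the parity of \<open>p - r\<close>, the sum in \<open>sum\<close> is
        \<open>2 * p + q + r + 2\<close> or \<open>2 * p + q + r + 1\<close>, never
        \<open>2 * p + q + r + 4\<close>.\<close>
      then show ?thesis
        using sum assms by linarith
    qed
  next
    case 5
    \<comment> \<open>The exclusion enters here: for \<open>p = r + 1\<close> and
      \<open>q = r + 3\<close>, the vertices \<open>p + q\<close> and \<open>p + q + r\<close> are
      both at distance \<open>r + 1\<close> from both landmarks.\<close>
    with assms show ?thesis
      by (simp add: dist_P1_def dist_P2_second_def) (smt (z3))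
  next
    case 6
    with assms show ?thesis
      by (simp add: dist_P1_def)
  qed
qed

text \<open>For \<open>1 \<le> d \<le> r\<close>, the vertices at distance \<open>d\<close> from
  \<open>p + q\<close> lie one each on P1, P3 and P2, at distances \<open>r + 1 - d\<close>,
  \<open>r + 2 - d\<close> and \<open>r + 3 - d\<close> from vertex 1. At distance
  \<open>r + 1\<close> there are \<open>1\<close>, \<open>p + 1\<close> and \<open>p + 2\<close>, at
  distances 0, 1 and 2 from vertex 1.\<close>

lemma inj_P1_P2_last:
  fixes p q r u v :: int
  assumes "r \<ge> 1" "p = r + 1" "q = r + 3"
    and "1 \<le> u" "u \<le> v" "v \<le> p + q + r"
    and "dist_P1 1 p q r u = dist_P1 1 p q r v"
    and "dist_P2_last p q r u = dist_P2_last p q r v"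
  shows "u = v"
proof -
  consider "v \<le> p" | "u \<le> p" "p < v" "v \<le> p + q" | "u \<le> p" "p + q < v"
    | "p < u" "v \<le> p + q" | "p < u" "u \<le> p + q" "p + q < v" | "p + q < u"
    using assms by linarith
  then show ?thesis
    using assms unfolding dist_P1_def dist_P2_last_def
    by cases (simp_all split: if_splits)
qed

section \<open>Verification of the distance formulas\<close>

lemma unit_steps_dist_P1:
  fixes p q r s :: int
  assumes "r \<ge> 1" "q > p" "p > r" "1 \<le> s" "p = r + 2 * s \<or> p + 1 = r + 2 * s"
  shows "unit_steps p q r (dist_P1 s p q r)"
  using assms unfolding unit_steps_def dist_P1_def
  by (intro conjI allI impI; smt (verit))

text \<open>On P1 the formula measures along the cycle through P1 and P3, of length
  \<open>p + r + 2\<close>; on P2 it compares the routes through \<open>p + 1\<close> and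
  \<open>p + q\<close>. On P3 the route through \<open>p + 1\<close> is never the longer one,
  because \<open>2 * s \<le> p - r + 1\<close>.\<close>

lemma distance_to_P1:
  fixes p q r s :: nat
  assumes "r \<ge> 1" "q > p" "p > r" "1 \<le> s" "p = r + 2 * s \<or> p + 1 = r + 2 * s"
  shows "distance_to (bicyclic p q r) s (dist_P1 s p q r \<circ> int)"
proof (rule distance_to_bicyclicI)
  note arc = arcs_bicyclic_iff bicyclic_edges_iff
  show "s \<in> {1..p + q + r}" "dist_P1 s p q r (int s) = 0"
    using assms by (auto simp: dist_P1_def)
  show "unit_steps p q r (dist_P1 s p q r)"
    using assms by (intro unit_steps_dist_P1) auto
  show "\<exists>w. (v, w) \<in> parcs (bicyclic p q r) \<and>
      dist_P1 s p q r (int v) = dist_P1 s p q r (int w) + 1"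
    if v: "1 \<le> v" "v \<le> p + q + r" "v \<noteq> s" for v
  proof -
    consider "v < s" | "s < v" "v \<le> p" | "v = p + 1" | "p + 1 < v" "v < p + q" | "v = p + q"
      | "v = p + q + 1" | "p + q + 1 < v"
      using v assms by linarith
    then show ?thesis
    proof cases
      case 1
      with v assms show ?thesis
        by (intro exI[of _ "v + 1"]) (auto simp: dist_P1_def arc)
    next
      case 2
      show ?thesis
      proof (cases "2 * v \<le> p + r + 2 + 2 * s")
        case True
        with 2 v assms show ?thesis
          by (intro exI[of _ "v - 1"]) (auto simp: dist_P1_def arc)
      next
        case False
        with 2 v assms show ?thesis
          by (intro exI[of _ "if v = p then p + q else v + 1"])
            (auto simp: dist_P1_def arc)
      qed
    next
      case 3
      with v assms show ?thesis
        by (intro exI[of _ "1"]) (auto simp: dist_P1_def arc)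
    next
      case 4
      show ?thesis
      \<comment> \<open>The threshold is where the two terms of the minimum on P2 meet; the descent
        goes towards the nearer branch vertex.\<close>
      proof (cases "2 * v + 2 * s \<le> 3 * p + q + 2")
        case True
        with 4 v assms show ?thesis
          by (intro exI[of _ "v - 1"]) (auto simp: dist_P1_def arc)
      next
        case False
        with 4 v assms show ?thesis
          by (intro exI[of _ "v + 1"]) (auto simp: dist_P1_def arc)
      qed
    next
      case 5
      with v assms show ?thesis
        by (intro exI[of _ "p"]) (auto simp: dist_P1_def arc)
    next
      case 6
      with v assms show ?thesis
        by (intro exI[of _ "p + 1"]) (auto simp: dist_P1_def arc)
    next
      case 7
      with v assms show ?thesis
        by (intro exI[of _ "v - 1"]) (auto simp: dist_P1_def arc)
    qed
  qed
qed

lemma unit_steps_dist_P2_second: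
  fixes p q r :: int
  assumes "r \<ge> 1" "q > p" "p > r"
  shows "unit_steps p q r (dist_P2_second p q r)"
  using assms unfolding unit_steps_def dist_P2_second_def
  by (intro conjI allI impI; smt (verit))

text \<open>The term \<open>min (q - 2) (r + 2)\<close> is the distance from \<open>p + 2\<close> to
  \<open>p + q\<close>, along P2 or back through \<open>p + 1\<close> and P3. The cycle through P2
  and P3 has length \<open>q + r\<close>.\<close>

lemma distance_to_P2_second:
  fixes p q r :: nat
  assumes "r \<ge> 1" "q > p" "p > r"
  shows "distance_to (bicyclic p q r) (p + 2) (dist_P2_second p q r \<circ> int)"
proof (rule distance_to_bicyclicI)
  note arc = arcs_bicyclic_iff bicyclic_edges_iff
  show "p + 2 \<in> {1..p + q + r}" "dist_P2_second p q r (int (p + 2)) = 0"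
    using assms by (auto simp: dist_P2_second_def)
  show "unit_steps p q r (dist_P2_second p q r)"
    using assms by (intro unit_steps_dist_P2_second) auto
  show "\<exists>w. (v, w) \<in> parcs (bicyclic p q r) \<and>
      dist_P2_second p q r (int v) = dist_P2_second p q r (int w) + 1"
    if v: "1 \<le> v" "v \<le> p + q + r" "v \<noteq> p + 2" for v
  proof -
    consider "v \<le> p" | "v = p + 1" | "p + 2 < v" "v \<le> p + q" | "v = p + q + 1" | "p + q + 1 < v"
      using v assms by linarith
    then show ?thesis
    proof cases
      case 1
      show ?thesis
      proof (cases "int v + 1 \<le> min (int q - 2) (r + 2) + p + 1 - v")
        case True
        with 1 v assms show ?thesis
          by (intro exI[of _ "if v = 1 then p + 1 else v - 1"])
            (auto simp: dist_P2_second_def arc)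
      next
        case False
        with 1 v assms show ?thesis
          by (intro exI[of _ "if v = p then p + q else v + 1"])
            (auto simp: dist_P2_second_def arc)
      qed
    next
      case 2
      with v assms show ?thesis
        by (intro exI[of _ "p + 2"]) (auto simp: dist_P2_second_def arc)
    next
      case 3
      show ?thesis
      proof (cases "2 * v \<le> 2 * p + q + r + 4")
        case True
        with 3 v assms show ?thesis
          by (intro exI[of _ "v - 1"]) (auto simp: dist_P2_second_def arc)
      next
        case False
        with 3 v assms show ?thesis
          by (intro exI[of _ "if v = p + q then p + q + r else v + 1"])
            (auto simp: dist_P2_second_def arc)
      qed
    next
      case 4
      with v assms show ?thesis
        by (intro exI[of _ "p + 1"]) (auto simp: dist_P2_second_def arc)
    next
      case 5
      show ?thesis
      proof (cases "2 * v + 2 \<le> 2 * p + 3 * q + r")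
        case True
        with 5 v assms show ?thesis
          by (intro exI[of _ "v - 1"]) (auto simp: dist_P2_second_def arc)
      next
        case False
        with 5 v assms show ?thesis
          by (intro exI[of _ "if v = p + q + r then p + q else v + 1"])
            (auto simp: dist_P2_second_def arc)
      qed
    qed
  qed
qed

lemma unit_steps_dist_P2_last:
  fixes p q r :: int
  assumes "r \<ge> 1" "p = r + 1" "q = r + 3"
  shows "unit_steps p q r (dist_P2_last p q r)"
  using assms unfolding unit_steps_def dist_P2_last_def
  by (intro conjI allI impI; smt (verit))

lemma distance_to_P2_last:
  fixes p q r :: nat
  assumes "r \<ge> 1" "p = r + 1" "q = r + 3"
  shows "distance_to (bicyclic p q r) (p + q) (dist_P2_last p q r \<circ> int)"
proof (rule distance_to_bicyclicI)
  note arc = arcs_bicyclic_iff bicyclic_edges_iff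
  show "p + q \<in> {1..p + q + r}" "dist_P2_last p q r (int (p + q)) = 0"
    using assms by (auto simp: dist_P2_last_def)
  show "unit_steps p q r (dist_P2_last p q r)"
    using assms by (intro unit_steps_dist_P2_last) auto
  show "\<exists>w. (v, w) \<in> parcs (bicyclic p q r) \<and>
      dist_P2_last p q r (int v) = dist_P2_last p q r (int w) + 1"
    if v: "1 \<le> v" "v \<le> p + q + r" "v \<noteq> p + q" for v
  proof -
    consider "v \<le> p" | "v = p + 1" | "p + 1 < v" "v < p + q" | "p + q < v"
      using v assms by linarith
    then show ?thesis
    proof cases
      case 1
      with v assms show ?thesis
        by (intro exI[of _ "if v = p then p + q else v + 1"])
          (auto simp: dist_P2_last_def arc)
    next
      case 2
      \<comment> \<open>From \<open>p + 1\<close> the way through P3 has length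
        \<open>r + 1\<close>, one less than the way along P2.\<close>
      with v assms show ?thesis
        by (intro exI[of _ "p + q + 1"]) (auto simp: dist_P2_last_def arc)
    next
      case 3
      with v assms show ?thesis
        by (intro exI[of _ "v + 1"]) (auto simp: dist_P2_last_def arc)
    next
      case 4
      with v assms show ?thesis
        by (intro exI[of _ "if v = p + q + r then p + q else v + 1"])
          (auto simp: dist_P2_last_def arc)
    qed
  qed
qed

section \<open>Resolving pairs and the metric dimension\<close>

lemma resolving_pair_exists:
  fixes p q r :: nat
  assumes "r \<ge> 1" "q > p" "p > r"
  obtains x y f g where "distance_to (bicyclic p q r) x f" "distance_to (bicyclic p q r) y g"
    "x \<noteq> y" "inj_on (\<lambda>v. (f v, g v)) (pverts (bicyclic p q r))"
proof (cases "p = r + 1 \<and> q = r + 3")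
  case True
  have "inj_on (\<lambda>v. ((dist_P1 1 p q r \<circ> int) v, (dist_P2_last p q r \<circ> int) v))
      (pverts (bicyclic p q r))"
    unfolding verts_bicyclic
  proof (rule linorder_inj_onI')
    fix u v assume uv: "u \<in> {1..p + q + r}" "v \<in> {1..p + q + r}" "u < v"
    show "((dist_P1 1 p q r \<circ> int) u, (dist_P2_last p q r \<circ> int) u) \<noteq>
        ((dist_P1 1 p q r \<circ> int) v, (dist_P2_last p q r \<circ> int) v)"
      using True assms inj_P1_P2_last[of r p q u v] uv by auto
  qed
  moreover have "distance_to (bicyclic p q r) 1 (dist_P1 1 p q r \<circ> int)"
    using distance_to_P1[of r p q 1] True assms by simp
  ultimately show ?thesis
    using that[of 1 _ "p + q"] distance_to_P2_last[of r p q] True assms by simp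
next
  case False
  define s where "s = (p - r + 1) div 2"
  have s: "1 \<le> s" "p = r + 2 * s \<or> p + 1 = r + 2 * s"
    using assms unfolding s_def by presburger+
  have "inj_on (\<lambda>v. ((dist_P1 s p q r \<circ> int) v, (dist_P2_second p q r \<circ> int) v))
      (pverts (bicyclic p q r))"
    unfolding verts_bicyclic
  proof (rule linorder_inj_onI')
    fix u v assume uv: "u \<in> {1..p + q + r}" "v \<in> {1..p + q + r}" "u < v"
    show "((dist_P1 s p q r \<circ> int) u, (dist_P2_second p q r \<circ> int) u) \<noteq>
        ((dist_P1 s p q r \<circ> int) v, (dist_P2_second p q r \<circ> int) v)"
      using False assms s inj_P1_P2_second[of r p q s u v] uv by auto
  qed
  moreover have "s \<noteq> p + 2"
    using assms s by auto
  ultimately show ?thesis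
    using that[of s _ "p + 2"] distance_to_P1[of r p q s] distance_to_P2_second[of r p q]
      s assms by blast
qed

theorem theorem4:
  fixes p q r :: nat
  assumes "p \<ge> 1" and "r \<ge> 1" and "q \<ge> 2"
    and "(q > p \<and> p > r) \<or> (q > r \<and> r > p)"
  shows "metric_dimension (bicyclic p q r) = 2"
proof -
  interpret G: pair_graph "bicyclic p q r"
    using assms by (intro pair_graph_bicyclic)
  have "\<exists>x y. resolving_set (bicyclic p q r) [x, y]"
  proof (cases "p > r")
    case True
    then have "q > p" using assms by auto
    then obtain x y f g where "distance_to (bicyclic p q r) x f"
        "distance_to (bicyclic p q r) y g" "x \<noteq> y"
        "inj_on (\<lambda>v. (f v, g v)) (pverts (bicyclic p q r))"
      by (rule resolving_pair_exists[OF assms(2) _ True])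
    then show ?thesis
      using G.resolving_set_two by blast
  next
    case False
    \<comment> \<open>The other order is the first with P1 and P3 exchanged: the landmarks are found
      in \<open>bicyclic r q p\<close> and pulled back along \<open>swap_vertex\<close>.\<close>
    then have "q > r" "r > p" using assms by auto
    then obtain x y f g where fg: "distance_to (bicyclic r q p) x f"
        "distance_to (bicyclic r q p) y g" "x \<noteq> y"
        "inj_on (\<lambda>v. (f v, g v)) (pverts (bicyclic r q p))"
      by (rule resolving_pair_exists[OF assms(1)])
    interpret swapped: pair_graph "bicyclic r q p"
      using assms by (intro pair_graph_bicyclic)
    let ?\<phi> = "swap_vertex p q r"
    have bij: "bij_betw ?\<phi> (pverts (bicyclic p q r)) (pverts (bicyclic r q p))"
      by (rule bij_betw_swap_vertex)
    have "x \<in> ?\<phi> ` pverts (bicyclic p q r)" "y \<in> ?\<phi> ` pverts (bicyclic p q r)"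
      using fg bij by (auto simp: distance_to_def bij_betw_def)
    then obtain x' y' where xy: "x = ?\<phi> x'" "x' \<in> pverts (bicyclic p q r)"
        "y = ?\<phi> y'" "y' \<in> pverts (bicyclic p q r)"
      by blast
    have "distance_to (bicyclic p q r) x' (f \<circ> ?\<phi>)" "distance_to (bicyclic p q r) y' (g \<circ> ?\<phi>)"
      using fg xy bij assms arcs_swap_vertex[of p q r]
        G.pair_wf_digraph_axioms swapped.pair_wf_digraph_axioms
      by (auto intro!: distance_to_vimage)
    moreover have "inj_on (\<lambda>v. ((f \<circ> ?\<phi>) v, (g \<circ> ?\<phi>) v)) (pverts (bicyclic p q r))"
      using comp_inj_on[of ?\<phi> _ "\<lambda>v. (f v, g v)"] bij fg by (auto simp: bij_betw_def comp_def)
    ultimately show ?thesis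
      using G.resolving_set_two[of x' "f \<circ> ?\<phi>" y' "g \<circ> ?\<phi>"] fg xy by auto
  qed
  then obtain x y where xy: "resolving_set (bicyclic p q r) [x, y]"
    by blast
  show ?thesis
  proof (rule G.metric_dimension_eq_two[OF _ _ xy])
    show "pverts (bicyclic p q r) \<noteq> {}"
      using assms by (simp add: verts_bicyclic)
  qed (use assms bicyclic_two_neighbours in blast)
qed

end
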